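(* There exists a universal constant $C<\infty$ such that $\inf_{z\in\mathbb{D}} f^\#(z)\le C$ for every function $f$ meromorphic in the open unit disk $\mathbb{D}$.
   Context: $\mathbb{D}=\{z\in\mathbb{C}:|z|<1\}$. The spherical derivative of a meromorphic function $f$ is $f^\#:=\frac{|f'|}{1+|f|^2}$, extended continuously to the poles of $f$ (equivalently, $f^\#(z_0)=(1/f)^\#(z_0)$ at a pole $z_0$). *)

theory Defs
  imports "HOL-Complex_Analysis.Complex_Analysis"
begin

text \<open>
  A meromorphic function is represented by a total function on \<open>\<complex>\<close>, whose values at poles (and at
  removable singularities, which \<^const>\<open>meromorphic_on\<close> permits) are irrelevant. The spherical
  derivative is therefore given by the usual formula only where the function is analytic; elsewhere
  it is the continuous extension. The limit exists by \<open>tendsto_spherical_deriv\<close> below, and it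
  agrees with the spherical derivative of the reciprocal by \<open>spherical_deriv_inverse\<close>.
\<close>
definition spherical_deriv :: "(complex \<Rightarrow> complex) \<Rightarrow> complex \<Rightarrow> real" where
  "spherical_deriv f z =
     (if f analytic_on {z} then cmod (deriv f z) / (1 + (cmod (f z))\<^sup>2)
      else Lim (at z) (\<lambda>w. cmod (deriv f w) / (1 + (cmod (f w))\<^sup>2)))"

lemma tendsto_spherical_formula_analytic:
  assumes "f analytic_on {z}"
  shows "((\<lambda>w. cmod (deriv f w) / (1 + (cmod (f w))\<^sup>2)) \<longlongrightarrow>
          cmod (deriv f z) / (1 + (cmod (f z))\<^sup>2)) (at z)"
proof -
  have "f \<midarrow>z\<rightarrow> f z"
    using assms analytic_at_imp_isCont isContD by blast
  moreover have "deriv f \<midarrow>z\<rightarrow> deriv f z"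
    using assms analytic_deriv analytic_at_imp_isCont isContD by blast
  moreover have "1 + (cmod (f z))\<^sup>2 \<noteq> 0"
    by (smt (verit) zero_le_power2)
  ultimately show ?thesis
    by (intro tendsto_intros)
qed

lemma spherical_deriv_analytic:
  assumes "f analytic_on {z}"
  shows "spherical_deriv f z = cmod (deriv f z) / (1 + (cmod (f z))\<^sup>2)"
  using assms by (simp add: spherical_deriv_def)

lemma eventually_eq_deriv_eq_at:
  fixes f g :: "complex \<Rightarrow> complex"
  assumes "eventually (\<lambda>w. f w = g w) (at z)"
  shows "eventually (\<lambda>w. f w = g w \<and> deriv f w = deriv g w) (at z)"
proof -
  from assms obtain S where S: "open S" "z \<in> S" "\<forall>w\<in>S. w \<noteq> z \<longrightarrow> f w = g w"
    unfolding eventually_at_topological by blast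
  have "f w = g w \<and> deriv f w = deriv g w" if "w \<in> S" "w \<noteq> z" for w
  proof -
    have "eventually (\<lambda>x. x \<in> S - {z}) (nhds w)"
      using S that by (intro eventually_nhds_in_open) auto
    hence "eventually (\<lambda>x. f x = g x) (nhds w)"
      by eventually_elim (use S in auto)
    thus ?thesis
      using deriv_cong_ev eventually_nhds_x_imp_x by blast
  qed
  thus ?thesis
    unfolding eventually_at_topological using S by blast
qed

lemma tendsto_spherical_formula_cong:
  assumes "eventually (\<lambda>w. f w = g w) (at z)" "g analytic_on {z}"
  shows "((\<lambda>w. cmod (deriv f w) / (1 + (cmod (f w))\<^sup>2)) \<longlongrightarrow> spherical_deriv g z) (at z)"
proof -
  have "eventually (\<lambda>w. cmod (deriv f w) / (1 + (cmod (f w))\<^sup>2) =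
                        cmod (deriv g w) / (1 + (cmod (g w))\<^sup>2)) (at z)"
    using eventually_eq_deriv_eq_at[OF assms(1)] by eventually_elim auto
  thus ?thesis
    using tendsto_spherical_formula_analytic[OF assms(2)] spherical_deriv_analytic[OF assms(2)]
    by (simp add: filterlim_cong)
qed

lemma spherical_deriv_eqI:
  assumes "((\<lambda>w. cmod (deriv f w) / (1 + (cmod (f w))\<^sup>2)) \<longlongrightarrow> L) (at z)"
  shows "spherical_deriv f z = L"
proof (cases "f analytic_on {z}")
  case True
  thus ?thesis
    using tendsto_spherical_formula_analytic[OF True] assms
    by (metis spherical_deriv_analytic LIM_unique)
next
  case False
  thus ?thesis
    using tendsto_Lim[OF _ assms] by (simp add: spherical_deriv_def)
qed

lemma tendsto_spherical_deriv_pole: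
  assumes "f meromorphic_on {z}" "is_pole f z"
  defines "g \<equiv> remove_sings (\<lambda>w. inverse (f w))"
  shows "((\<lambda>w. cmod (deriv f w) / (1 + (cmod (f w))\<^sup>2)) \<longlongrightarrow> spherical_deriv g z) (at z)"
    and "g analytic_on {z}" "g z = 0"
proof -
  have mero: "(\<lambda>w. inverse (f w)) meromorphic_on {z}"
    using assms(1) by (intro meromorphic_intros)
  have lim: "(\<lambda>w. inverse (f w)) \<midarrow>z\<rightarrow> 0"
    using assms(2) unfolding is_pole_def by (rule tendsto_inverse_0[THEN filterlim_compose])
  show g: "g analytic_on {z}"
    unfolding g_def using mero lim by (meson meromorphic_at_iff remove_sings_analytic_at)
  show gz: "g z = 0"
    unfolding g_def using lim by blast
  have ev_g: "eventually (\<lambda>w. inverse (f w) = g w) (at z)"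
    using eventually_remove_sings_eq_at mero meromorphic_at_iff
    unfolding g_def by (metis (mono_tags, lifting) eventually_mono)
  have "eventually (\<lambda>w. f w = inverse (g w)) (at z)"
    using ev_g by eventually_elim (metis inverse_inverse_eq)
  hence ev: "eventually (\<lambda>w. f w = inverse (g w) \<and> deriv f w = deriv (\<lambda>w. inverse (g w)) w) (at z)"
    by (rule eventually_eq_deriv_eq_at)
  have nz: "eventually (\<lambda>w. f w \<noteq> 0) (at z)"
    using assms(2) non_zero_neighbour_pole by blast
  have "eventually (\<lambda>w. g analytic_on {w}) (at z)"
    using g isolated_singularity_at_altdef isolated_singularity_at_analytic by blast
  hence "eventually (\<lambda>w. cmod (deriv f w) / (1 + (cmod (f w))\<^sup>2) =
                        cmod (deriv g w) / (1 + (cmod (g w))\<^sup>2)) (at z)"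
    using ev nz
  proof eventually_elim
    case (elim w)
    have gw: "g w \<noteq> 0"
      using elim by auto
    have "(g has_field_derivative deriv g w) (at w)"
      using elim analytic_at_imp_isCont analytic_on_imp_differentiable_at
      by (metis DERIV_deriv_iff_field_differentiable insertI1)
    hence "deriv (\<lambda>w. inverse (g w)) w = - (inverse (g w) * deriv g w * inverse (g w))"
      using gw by (intro DERIV_imp_deriv DERIV_inverse')
    hence "deriv f w = - (deriv g w / (g w)\<^sup>2)"
      using elim by (simp add: field_simps power2_eq_square)
    moreover have "f w = inverse (g w)"
      using elim by simp
    ultimately have "cmod (deriv f w) / (1 + (cmod (f w))\<^sup>2) =
        (cmod (deriv g w) / (cmod (g w))\<^sup>2) / (1 + inverse ((cmod (g w))\<^sup>2))"
      by (simp add: norm_divide norm_power norm_inverse power_inverse)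
    also have "\<dots> = cmod (deriv g w) / (1 + (cmod (g w))\<^sup>2)"
    proof -
      have aux: "a / c / (1 + inverse c) = a / (1 + c)" if "c > 0" for a c :: real
        using that by (simp add: field_simps)
      show ?thesis
        using gw by (intro aux) simp
    qed
    finally show ?case .
  qed
  thus "((\<lambda>w. cmod (deriv f w) / (1 + (cmod (f w))\<^sup>2)) \<longlongrightarrow> spherical_deriv g z) (at z)"
    using tendsto_spherical_formula_analytic[OF g] spherical_deriv_analytic[OF g]
    by (simp add: filterlim_cong)
qed

lemma spherical_deriv_inverse:
  assumes "f meromorphic_on {z}" "is_pole f z"
  shows "spherical_deriv f z = spherical_deriv (remove_sings (\<lambda>w. inverse (f w))) z"
  using tendsto_spherical_deriv_pole(1)[OF assms] by (rule spherical_deriv_eqI)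

lemma tendsto_spherical_deriv:
  assumes "f meromorphic_on {z}"
  shows "((\<lambda>w. cmod (deriv f w) / (1 + (cmod (f w))\<^sup>2)) \<longlongrightarrow> spherical_deriv f z) (at z)"
proof (cases "is_pole f z")
  case True
  thus ?thesis
    using tendsto_spherical_deriv_pole(1)[OF assms] spherical_deriv_inverse[OF assms] by simp
next
  case False
  then obtain c where c: "f \<midarrow>z\<rightarrow> c"
    using assms unfolding meromorphic_at_iff not_essential_def by blast
  have "remove_sings f analytic_on {z}"
    using assms c by (meson meromorphic_at_iff remove_sings_analytic_at)
  moreover have "eventually (\<lambda>w. f w = remove_sings f w) (at z)"
    using assms eventually_remove_sings_eq_at meromorphic_at_iff
    by (metis (mono_tags, lifting) eventually_mono)
  ultimately have
    "((\<lambda>w. cmod (deriv f w) / (1 + (cmod (f w))\<^sup>2)) \<longlongrightarrow> spherical_deriv (remove_sings f) z) (at z)"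
    by (intro tendsto_spherical_formula_cong)
  thus ?thesis
    using spherical_deriv_eqI by metis
qed

lemma spherical_deriv_nonneg:
  assumes "f meromorphic_on {z}"
  shows "spherical_deriv f z \<ge> 0"
  by (rule tendsto_lowerbound[OF tendsto_spherical_deriv[OF assms]]) auto

end

theory Submission
  imports Defs
begin

text \<open>
  Suppose that \<open>f\<^sup># \<ge> c > 0\<close> throughout the disk. Then \<open>f\<close> is locally univalent and can be written as a
  quotient \<open>w\<^sub>1 / w\<^sub>2\<close> of holomorphic functions with \<open>w\<^sub>2\<^sup>2 = 1 / f'\<close> and Wronskian
  \<open>w\<^sub>1' w\<^sub>2 - w\<^sub>1 w\<^sub>2' = f' w\<^sub>2\<^sup>2 = 1\<close>, and the spherical derivative becomes
  \<open>f\<^sup># = 1 / (\<bar>w\<^sub>1\<bar>\<^sup>2 + \<bar>w\<^sub>2\<bar>\<^sup>2)\<close>. A lower bound on \<open>f\<^sup>#\<close> is therefore an upper bound on \<open>w\<^sub>1\<close> and \<open>w\<^sub>2\<close>,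
  hence by Cauchy's inequality on their derivatives, and if \<open>c\<close> is large this contradicts the
  Wronskian being \<open>1\<close>.

  The products \<open>u = w\<^sub>1\<^sup>2 = f\<^sup>2 / f'\<close>, \<open>m = w\<^sub>1 w\<^sub>2 = f / f'\<close> and \<open>v = w\<^sub>2\<^sup>2 = 1 / f'\<close> carry the same information
  and avoid choosing a square root of \<open>1 / f'\<close> near its double zeros, the poles of \<open>f\<close>. They are
  bounded by \<open>1 / c\<close> wherever \<open>f\<close> is analytic, so the exceptional points are removable and Cauchy's
  inequality applies (\<open>bounded_meromorphic_deriv_le\<close>). The Wronskian identity turns into
  \<open>m' - f v' = 1\<close> and \<open>u' / f - m' = 1\<close>; at any point one of the two has coefficients of modulus at most
  \<open>1\<close>, which bounds \<open>c\<close> (\<open>spherical_deriv_lower_bound_le\<close>).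
\<close>

text \<open>
  Cauchy's inequality survives singularities near which the function stays bounded, because they are
  removable. The bound is only asked for on punctured neighbourhoods, so that the arbitrary values
  of \<open>g\<close> at its singularities do not matter.
\<close>

lemma bounded_meromorphic_deriv_le:
  assumes mero: "g meromorphic_on A" and A: "open A" "cball a r \<subseteq> A" and r: "r > 0"
    and bound: "\<And>z. z \<in> A \<Longrightarrow> \<forall>\<^sub>F w in at z. cmod (g w) \<le> M"
    and ana: "g analytic_on {a}"
  shows "cmod (deriv g a) \<le> M / r"
proof -
  define G where "G = remove_sings g"
  have G: "G analytic_on {z} \<and> cmod (G z) \<le> M" if z: "z \<in> A" for z
  proof -
    have sing: "isolated_singularity_at g z" "not_essential g z"
      using mero z meromorphic_on_subset[of g A "{z}"] by (auto simp: meromorphic_at_iff)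
    have "\<not> is_pole g z"
    proof
      assume "is_pole g z"
      hence "\<forall>\<^sub>F w in at z. cmod (g w) \<ge> M + 1"
        by (simp add: is_pole_def filterlim_at_infinity_conv_norm_at_top filterlim_at_top)
      hence "\<forall>\<^sub>F w in at z. False"
        using bound[OF z] by eventually_elim auto
      thus False by simp
    qed
    then obtain c where c: "g \<midarrow>z\<rightarrow> c"
      using sing unfolding not_essential_def by blast
    have "cmod c \<le> M"
      by (rule tendsto_upperbound[OF tendsto_norm[OF c] bound[OF z]]) auto
    moreover have "G z = c"
      unfolding G_def using c by (rule remove_sings_eqI)
    moreover have "G analytic_on {z}"
      unfolding G_def using remove_sings_analytic_at[OF sing(1) c] by simp
    ultimately show ?thesis by simp
  qed
  have hol: "G holomorphic_on A"
    by (intro analytic_imp_holomorphic) (use G analytic_on_analytic_at in blast)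
  have "cmod ((deriv ^^ 1) G a) \<le> fact 1 * M / r ^ 1"
  proof (rule Cauchy_inequality)
    show "G holomorphic_on ball a r"
      using hol A by (meson ball_subset_cball holomorphic_on_subset order_trans)
    show "continuous_on (cball a r) G"
      using hol A by (meson holomorphic_on_imp_continuous_on holomorphic_on_subset)
    show "cmod (G x) \<le> M" if "cmod (a - x) = r" for x
      using G A that by (auto simp: subset_iff dist_norm)
  qed (use r in auto)
  moreover have "deriv G a = deriv g a"
    unfolding G_def using ana by simp
  ultimately show ?thesis by simp
qed

text \<open>
  The heart of the argument: a function whose spherical derivative is bounded below on a disk
  of radius \<open>r\<close> satisfies a Bloch-type bound that scales like \<open>1 / r\<close>.
\<close>
lemma spherical_deriv_lower_bound_le:
  assumes mero: "f meromorphic_on A" and A: "open A" "cball a r \<subseteq> A" and r: "r > 0"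
    and lower: "\<And>z. z \<in> A \<Longrightarrow> c \<le> spherical_deriv f z" and c: "c > 0"
    and ana: "f analytic_on {a}"
  shows "c \<le> 2 / r"
proof -
  define u m v where "u = (\<lambda>z. (f z)\<^sup>2 / deriv f z)" and "m = (\<lambda>z. f z / deriv f z)"
    and "v = (\<lambda>z. 1 / deriv f z)"
  have bounds: "cmod (u w) \<le> 1 / c" "cmod (m w) \<le> 1 / c" "cmod (v w) \<le> 1 / c" "deriv f w \<noteq> 0"
    if "f analytic_on {w}" "w \<in> A" for w
  proof -
    let ?s = "1 + (cmod (f w))\<^sup>2"
    have s: "?s > 0" by (smt (verit) zero_le_power2)
    have "c \<le> cmod (deriv f w) / ?s"
      using lower[OF that(2)] that(1) by (simp add: spherical_deriv_analytic)
    hence *: "c * ?s \<le> cmod (deriv f w)"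
      using s by (simp add: pos_le_divide_eq)
    have pos: "cmod (deriv f w) > 0"
      using * s c by (smt (verit) mult_pos_pos)
    thus "deriv f w \<noteq> 0" by auto
    \<comment> \<open>The numerators of \<open>u\<close>, \<open>m\<close> and \<open>v\<close> are all at most \<open>1 + \<bar>f\<bar>\<^sup>2\<close>.\<close>
    have le: "t / cmod (deriv f w) \<le> 1 / c" if "t \<le> ?s" for t
    proof -
      have "c * t \<le> c * ?s" using that c by (intro mult_left_mono) auto
      with * show ?thesis using pos c by (simp add: field_simps)
    qed
    have "0 \<le> (cmod (f w) - 1)\<^sup>2" by simp
    hence "cmod (f w) \<le> ?s" by (simp add: power2_diff) (smt (verit) norm_ge_zero zero_le_power2)
    thus "cmod (u w) \<le> 1 / c" "cmod (m w) \<le> 1 / c" "cmod (v w) \<le> 1 / c"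
      using le by (auto simp: u_def m_def v_def norm_divide norm_power)
  qed
  have a: "a \<in> A" using A r by auto
  have ev: "\<forall>\<^sub>F w in at z. cmod (u w) \<le> 1 / c \<and> cmod (m w) \<le> 1 / c \<and> cmod (v w) \<le> 1 / c"
    if "z \<in> A" for z
  proof -
    have "isolated_singularity_at f z"
      using mero that meromorphic_on_subset[of f A "{z}"] by (auto simp: meromorphic_at_iff)
    hence "\<forall>\<^sub>F w in at z. f analytic_on {w}"
      by (simp add: isolated_singularity_at_altdef)
    moreover have "\<forall>\<^sub>F w in at z. w \<in> A"
      using A(1) that by (rule eventually_at_in_open')
    ultimately show ?thesis
      by eventually_elim (use bounds in auto)
  qed
  have nz: "deriv f a \<noteq> 0" using bounds(4)[OF ana a] .
  have est: "cmod (deriv g a) \<le> 1 / c / r"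
    if "g meromorphic_on A" "g analytic_on {a}"
       "\<And>z. z \<in> A \<Longrightarrow> \<forall>\<^sub>F w in at z. cmod (g w) \<le> 1 / c" for g
    using bounded_meromorphic_deriv_le[OF that(1) A r that(3) that(2)] .
  have u': "cmod (deriv u a) \<le> 1 / c / r"
  proof (rule est)
    show "u meromorphic_on A"
      unfolding u_def using mero by (intro meromorphic_intros)
    show "u analytic_on {a}"
      unfolding u_def using ana nz by (intro analytic_intros analytic_deriv) auto
    show "\<forall>\<^sub>F w in at z. cmod (u w) \<le> 1 / c" if "z \<in> A" for z
      using ev[OF that] by eventually_elim simp
  qed
  have m': "cmod (deriv m a) \<le> 1 / c / r"
  proof (rule est)
    show "m meromorphic_on A"
      unfolding m_def using mero by (intro meromorphic_intros)
    show "m analytic_on {a}"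
      unfolding m_def using ana nz by (intro analytic_intros analytic_deriv) auto
    show "\<forall>\<^sub>F w in at z. cmod (m w) \<le> 1 / c" if "z \<in> A" for z
      using ev[OF that] by eventually_elim simp
  qed
  have v': "cmod (deriv v a) \<le> 1 / c / r"
  proof (rule est)
    show "v meromorphic_on A"
      unfolding v_def using mero by (intro meromorphic_intros)
    show "v analytic_on {a}"
      unfolding v_def using ana nz by (intro analytic_intros analytic_deriv) auto
    show "\<forall>\<^sub>F w in at z. cmod (v w) \<le> 1 / c" if "z \<in> A" for z
      using ev[OF that] by eventually_elim simp
  qed
  \<comment> \<open>All three derivatives are expressed by the same second-order quantity, so it can be eliminated.\<close>
  define q where "q = f a * deriv (deriv f) a / (deriv f a)\<^sup>2"
  have df: "(f has_field_derivative deriv f a) (at a)"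
    using ana analytic_derivI by blast
  have ddf: "(deriv f has_field_derivative deriv (deriv f) a) (at a)"
    using ana analytic_deriv analytic_derivI by blast
  have eqs: "deriv m a = 1 - q" "deriv u a = f a * (2 - q)" "f a * deriv v a = - q"
  proof -
    have "(m has_field_derivative 1 - q) (at a)"
      unfolding m_def
      by (rule derivative_eq_intros df ddf nz refl)+
         (use nz in \<open>simp add: q_def field_simps power2_eq_square\<close>)
    thus "deriv m a = 1 - q" by (rule DERIV_imp_deriv)
    have "(u has_field_derivative f a * (2 - q)) (at a)"
      unfolding u_def
      by (rule derivative_eq_intros df ddf nz refl)+
         (use nz in \<open>simp add: q_def field_simps power2_eq_square\<close>)
    thus "deriv u a = f a * (2 - q)" by (rule DERIV_imp_deriv)
    have "(v has_field_derivative - (deriv (deriv f) a / (deriv f a)\<^sup>2)) (at a)"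
      unfolding v_def
      by (rule derivative_eq_intros df ddf nz refl)+
         (use nz in \<open>simp add: field_simps power2_eq_square\<close>)
    hence "deriv v a = - (deriv (deriv f) a / (deriv f a)\<^sup>2)" by (rule DERIV_imp_deriv)
    thus "f a * deriv v a = - q" by (simp add: q_def)
  qed
  \<comment> \<open>The two cases are exchanged by passing from \<open>f\<close> to \<open>1 / f\<close>, which keeps \<open>f\<^sup>#\<close> and swaps \<open>u\<close> with \<open>v\<close>
    up to sign.\<close>
  have "1 \<le> 1 / c / r + 1 / c / r"
  proof (cases "cmod (f a) \<le> 1")
    case True
    have "1 = cmod (deriv m a - f a * deriv v a)"
      by (simp add: eqs)
    also have "\<dots> \<le> cmod (deriv m a) + cmod (f a) * cmod (deriv v a)"
      by (metis norm_mult norm_triangle_ineq4)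
    also have "cmod (f a) * cmod (deriv v a) \<le> cmod (deriv v a)"
      using True by (simp add: mult_left_le_one_le)
    finally show ?thesis using m' v' by linarith
  next
    case False
    hence "1 = cmod (deriv u a / f a - deriv m a)"
      by (auto simp: eqs)
    also have "\<dots> \<le> cmod (deriv u a) / cmod (f a) + cmod (deriv m a)"
      by (metis norm_divide norm_triangle_ineq4)
    also have "cmod (deriv u a) / cmod (f a) \<le> cmod (deriv u a)"
      using False frac_le[of "cmod (deriv u a)" "cmod (deriv u a)" 1 "cmod (f a)"] by simp
    finally show ?thesis using m' u' by linarith
  qed
  thus ?thesis using c r by (simp add: field_simps)
qed

theorem corollary2:
  shows "\<exists>C::real. \<forall>f. f meromorphic_on ball 0 1 \<longrightarrow> (INF z\<in>ball 0 1. spherical_deriv f z) \<le> C"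
proof (intro exI[of _ 4] allI impI)
  fix f :: "complex \<Rightarrow> complex"
  assume mero: "f meromorphic_on ball 0 1"
  define c where "c = (INF z\<in>ball 0 1. spherical_deriv f z)"
  have nonneg: "spherical_deriv f z \<ge> 0" if "z \<in> ball 0 1" for z
    using spherical_deriv_nonneg meromorphic_on_subset[OF mero] that by simp
  have lower: "c \<le> spherical_deriv f z" if "z \<in> ball 0 1" for z
    unfolding c_def using that nonneg by (intro cINF_lower bdd_belowI2[of _ 0]) auto
  \<comment> \<open>The origin may be a pole, so the estimate is centred at a nearby point of analyticity \<open>a\<close>. With
    \<open>\<bar>a\<bar> < 1 / 2\<close> a disk of radius \<open>1 / 2\<close> still fits, and the constant is \<open>2 / (1 / 2) = 4\<close>.\<close>
  have "isolated_singularity_at f 0"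
    using meromorphic_on_subset[OF mero, of "{0}"] by (auto simp: meromorphic_at_iff)
  hence "\<forall>\<^sub>F w in at 0. f analytic_on {w}"
    by (simp add: isolated_singularity_at_altdef)
  moreover have "\<forall>\<^sub>F w in at (0::complex). w \<in> ball 0 (1 / 2)"
    by (rule eventually_at_in_open') auto
  ultimately have "\<forall>\<^sub>F w in at 0. f analytic_on {w} \<and> w \<in> ball 0 (1 / 2)"
    by (rule eventually_conj)
  then obtain a where a: "f analytic_on {a}" "a \<in> ball 0 (1 / 2)"
    using eventually_happens trivial_limit_at by blast
  have "cball a (1 / 2) \<subseteq> ball 0 1"
    using a(2) by (auto simp: cball_subset_ball_iff)
  hence "c \<le> 2 / (1 / 2)" if "c > 0"
    using spherical_deriv_lower_bound_le[OF mero _ _ _ lower that a(1), of "1 / 2"] by simp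
  thus "(INF z\<in>ball 0 1. spherical_deriv f z) \<le> 4"
    unfolding c_def[symmetric] by (cases "c > 0") auto
qed

end
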